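(* Let $U$ and $V$ be Banach spaces, $\Lambda$ a set, $F_{\varepsilon,\lambda}:U\to V$ (with $\varepsilon>0$ and $\lambda\in\Lambda$) a family of differentiable maps, $F_0:U\to V$ a differentiable map, and $u_0\in U$ an element such that the following is true: (1) $V$ is compactly embedded into $U$; (2) $u_0=F_0(u_0)$; (3) $\ker(I-F_0'(u_0))=\{0\}$; (4) $\sup\{\|F'_{\varepsilon,\lambda}(u_0)u\|_V:\ \varepsilon>0,\ \lambda\in\Lambda,\ u\in U,\ \|u\|_U\le1\}<\infty$; (5) $\displaystyle\lim_{\varepsilon+\|u\|_U\to0}\ \sup_{\|v\|_U\le1}\|(F'_{\varepsilon,\lambda}(u_0+u)-F'_{\varepsilon,\lambda}(u_0))v\|_U=0$ uniformly with respect to $\lambda\in\Lambda$; (6) $\displaystyle\lim_{\varepsilon\to0}\|F_{\varepsilon,\lambda}(u_0)-F_0(u_0)\|_U=0$ uniformly with respect to $\lambda\in\Lambda$; (7) for all $u\in U$, $\displaystyle\lim_{\varepsilon\to0}\|(F'_{\varepsilon,\lambda}(u_0)-F'_0(u_0))u\|_U=0$ uniformly with respect to $\lambda\in\Lambda$. Then there exist $\varepsilon_0>0$ and $\delta>0$ such that for all $\varepsilon\in(0,\varepsilon_0]$ and $\lambda\in\Lambda$ there exists exactly one $u=u_{\varepsilon,\lambda}\in U$ with $u=F_{\varepsilon,\lambda}(u)$ and $\|u-u_0\|_U\le\delta$. Moreover, there exists $\rho>0$ such that $$\|u_{\varepsilon,\lambda}-u_0\|_U\le\rho\,\|F_{\varepsilon,\lambda}(u_0)-F_0(u_0)\|_U\quad\text{for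 all }\varepsilon\in(0,\varepsilon_0]\text{ and }\lambda\in\Lambda.$$
   Context: Differentiable means Fréchet differentiable from $U$ into $V$; $F'(u)$ denotes the derivative at $u$, a bounded linear operator from $U$ to $V$. Via the embedding, $V$ is regarded as a subspace of $U$ (with compact inclusion), so the $F_{\varepsilon,\lambda}$, $F_0$ and their derivatives are also regarded as maps from $U$ into $U$; $I$ is the identity of $U$, and the kernel in (3) is taken in $U$. *)

theory Defs
  imports "HOL-Analysis.Analysis"
begin

definition compact_embedding :: "('v::real_normed_vector \<Rightarrow> 'u::real_normed_vector) \<Rightarrow> bool" where
  "compact_embedding j \<longleftrightarrow>
     bounded_linear j \<and> inj j \<and> (\<forall>B. bounded B \<longrightarrow> compact (closure (j ` B)))"

text \<open>
  The filter of pairs \<open>(\<epsilon>, u)\<close> with \<open>\<epsilon> > 0\<close> and \<open>u\<close> arbitrary (\<open>u = 0\<close> included)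
  for the limit \<open>\<epsilon> + \<parallel>u\<parallel> \<rightarrow> 0\<close>.
\<close>
definition eps_norm_to_0 :: "(real \<times> 'u::real_normed_vector) filter" where
  "eps_norm_to_0 =
     inf (filtercomap (\<lambda>(\<epsilon>, u). \<epsilon> + norm u) (nhds 0)) (principal ({0<..} \<times> UNIV))"

abbreviation fderiv :: "('u::real_normed_vector \<Rightarrow> 'v::real_normed_vector) \<Rightarrow> 'u \<Rightarrow> 'u \<Rightarrow> 'v" where
  "fderiv f u \<equiv> frechet_derivative f (at u)"

end

theory Submission
  imports Defs
begin

text \<open>
  The operators \<open>A = j F'\<^sub>\<epsilon>\<^sub>,\<^sub>\<lambda>(u\<^sub>0)\<close> map the unit ball into one common compact set and converge
  strongly to \<open>j F\<^sub>0'(u\<^sub>0)\<close>, so injectivity of \<open>I - j F\<^sub>0'(u\<^sub>0)\<close> forces a lower bound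
  \<open>c\<parallel>u\<parallel> \<le> \<parallel>u - A u\<parallel>\<close> that is uniform in small \<open>\<epsilon>\<close> and in \<open>\<lambda>\<close>. By the Fredholm alternative
  each \<open>I - A\<close> is then onto, with inverse bounded by \<open>1/c\<close>, and the Newton map
  \<open>u \<mapsto> u - (I - A)\<^sup>-\<^sup>1 (u - j F\<^sub>\<epsilon>\<^sub>,\<^sub>\<lambda>(u))\<close> contracts a fixed small ball about \<open>u\<^sub>0\<close> with
  factor \<open>1/2\<close>.
\<close>

section \<open>Riesz' lemma and the Fredholm alternative\<close>

text \<open>Pick \<open>s\<close> in \<open>S\<close> almost realising the distance \<open>d\<close>
  from \<open>y\<close> to \<open>S\<close> and normalise \<open>y - s\<close>: rescaling by
  \<open>n = norm (y - s)\<close> turns a distance to \<open>S\<close> from the unit vector into one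
  from \<open>y\<close>, which is at least \<open>d\<close>.\<close>

lemma Riesz_almost_orthogonal:
  fixes S T :: "'a::real_normed_vector set"
  assumes "subspace S" "subspace T" "closed S" "S \<subseteq> T" "y \<in> T" "y \<notin> S" and r: "r < 1"
  shows "\<exists>x. x \<in> T \<and> norm x = 1 \<and> (\<forall>z\<in>S. r \<le> norm (x - z))"
proof -
  define d where "d = infdist y S"
  have ne: "S \<noteq> {}"
    using subspace_0[OF \<open>subspace S\<close>] by auto
  have d: "d > 0"
    unfolding d_def using infdist_pos_not_in_closed assms ne by blast
  \<comment> \<open>The maximum keeps the factor positive even if \<open>r\<close> is not, so that
    \<open>d / q\<close> is a genuine upper margin over \<open>d\<close>.\<close>
  define q where "q = max r (1/2)"
  have q: "0 < q" "q < 1" "r \<le> q"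
    using r by (auto simp: q_def)
  have "d < d / q"
    using d q by (simp add: field_simps)
  then obtain s where s: "s \<in> S" "dist y s < d / q"
    unfolding d_def infdist_notempty[OF ne]
    by (subst (asm) cINF_less_iff) (use ne in \<open>auto intro!: bdd_belowI2[of _ 0]\<close>)
  define n where "n = norm (y - s)"
  have n: "n > 0" "q * n < d"
    using s q \<open>y \<notin> S\<close> by (auto simp: n_def dist_norm field_simps)
  show ?thesis
  proof (intro exI[of _ "(1 / n) *\<^sub>R (y - s)"] conjI ballI)
    show "(1 / n) *\<^sub>R (y - s) \<in> T"
      using assms s by (meson subspace_scale subspace_diff subsetD)
    show "norm ((1 / n) *\<^sub>R (y - s)) = 1"
      using n by (simp add: n_def)
    fix z assume "z \<in> S"
    then have "s + n *\<^sub>R z \<in> S"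
      using assms s by (meson subspace_scale subspace_add)
    then have "d \<le> norm (y - (s + n *\<^sub>R z))"
      unfolding d_def dist_norm[symmetric] by (rule infdist_le)
    also have "y - (s + n *\<^sub>R z) = n *\<^sub>R ((1 / n) *\<^sub>R (y - s) - z)"
      using n by (simp add: algebra_simps)
    finally have "d \<le> n * norm ((1 / n) *\<^sub>R (y - s) - z)"
      using n by simp
    with n(2) have "n * q < n * norm ((1 / n) *\<^sub>R (y - s) - z)"
      by (metis mult.commute order_less_le_trans)
    then have "q < norm ((1 / n) *\<^sub>R (y - s) - z)"
      using n(1) by (simp only: mult_less_cancel_left_pos)
    then show "r \<le> norm ((1 / n) *\<^sub>R (y - s) - z)"
      using q by linarith
  qed
qed

text \<open>
  If \<open>I - T\<close> were not onto, its powers would have strictly decreasing closed ranges, and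
  almost orthogonal unit vectors chosen from these ranges would have images under \<open>T\<close> that
  stay at distance at least \<open>1/2\<close> from each other.
\<close>
lemma Fredholm_surj:
  fixes T :: "'a::banach \<Rightarrow> 'a"
  assumes T: "bounded_linear T" and cpt: "compact (closure (T ` cball 0 1))"
    and c: "c > 0" and lower: "\<And>x. c * norm x \<le> norm (x - T x)"
  shows "surj (\<lambda>x. x - T x)"
proof (rule ccontr)
  define S where "S = (\<lambda>x. x - T x)"
  assume "\<not> surj (\<lambda>x. x - T x)"
  then obtain y where y: "y \<notin> range S"
    by (auto simp: S_def)
  have S: "bounded_linear S"
    unfolding S_def using T by (intro bounded_linear_intros)
  then interpret S: bounded_linear S .
  have lowerS: "c * norm x \<le> norm (S x)" for x
    using lower by (simp add: S_def)
  have "inj S"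
  proof (rule injI)
    fix a b assume "S a = S b"
    then show "a = b"
      using lower[of "a - b"] c S.diff[of a b] by (simp add: S_def mult_le_0_iff)
  qed
  define R where "R n = range (S ^^ n)" for n
  have R_Suc: "R (Suc n) = S ` R n" for n
    by (auto simp: R_def image_comp)
  \<comment> \<open>Completeness, unlike mere closedness, passes directly to images under a linear
    map that is bounded below.\<close>
  have R: "subspace (R n) \<and> complete (R n)" for n
  proof (induction n)
    case 0
    then show ?case by (simp add: R_def complete_UNIV)
  next
    case (Suc n)
    then show ?case
      unfolding R_Suc using lowerS
      by (auto intro!: complete_isometric_image[OF c _ S] linear_subspace_image S.linear)
  qed
  have dec: "R m \<subseteq> R n" if "n \<le> m" for n m
  proof -
    have "S ^^ m = S ^^ n \<circ> S ^^ (m - n)"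
      using that by (simp flip: funpow_add)
    then show ?thesis by (auto simp: R_def)
  qed
  have "\<exists>x. x \<in> R n \<and> norm x = 1 \<and> (\<forall>z\<in>R (Suc n). 1/2 \<le> norm (x - z))" for n
  proof -
    \<comment> \<open>The ranges decrease strictly: cancelling the injective \<open>S ^^ n\<close>
      would put \<open>y\<close> into the range of \<open>S\<close>.\<close>
    have "(S ^^ n) y \<notin> R (Suc n)"
    proof
      assume "(S ^^ n) y \<in> R (Suc n)"
      then obtain w where "(S ^^ n) y = (S ^^ n) (S w)"
        by (auto simp: R_def funpow_swap1)
      then have "y = S w"
        using inj_fn[OF \<open>inj S\<close>, of n] by (auto dest: injD)
      then show False using y by auto
    qed
    moreover have "(S ^^ n) y \<in> R n" by (auto simp: R_def)
    moreover have "closed (R (Suc n))" "R (Suc n) \<subseteq> R n"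
      using R complete_imp_closed dec by auto
    ultimately show ?thesis
      using R by (intro Riesz_almost_orthogonal[where y = "(S ^^ n) y"]) auto
  qed
  then obtain x where x: "\<And>n. x n \<in> R n" "\<And>n. norm (x n) = 1"
    "\<And>n z. z \<in> R (Suc n) \<Longrightarrow> 1/2 \<le> norm (x n - z)"
    by metis
  have sep: "1/2 \<le> norm (T (x n) - T (x m))" if "n < m" for n m
  proof -
    \<comment> \<open>As \<open>T = I - S\<close>, the difference \<open>T (x n) - T (x m)\<close>
      is \<open>x n\<close> minus \<open>S (x n) + x m - S (x m)\<close>, a vector of
      \<open>R (Suc n)\<close>.\<close>
    have "x m \<in> R (Suc n)" "S (x m) \<in> R (Suc n)" "S (x n) \<in> R (Suc n)"
      using x(1)[of n] x(1)[of m] dec[of "Suc n" m] dec[of n m] that by (auto simp: R_Suc)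
    then have "S (x n) + x m - S (x m) \<in> R (Suc n)"
      using R by (blast intro: subspace_add subspace_diff)
    from x(3)[OF this] show ?thesis
      by (simp add: S_def algebra_simps)
  qed
  have "T (x n) \<in> closure (T ` cball 0 1)" for n
    using x(2)[of n] closure_subset by fastforce
  with cpt obtain l r where r: "strict_mono r" "((\<lambda>n. T (x n)) \<circ> r) \<longlonglongrightarrow> l"
    unfolding compact_def by meson
  then have "Cauchy ((\<lambda>n. T (x n)) \<circ> r)"
    using LIMSEQ_imp_Cauchy by blast
  then obtain M where "\<And>m n. m \<ge> M \<Longrightarrow> n \<ge> M \<Longrightarrow> dist (T (x (r m))) (T (x (r n))) < 1/2"
    using metric_CauchyD[of "(\<lambda>n. T (x n)) \<circ> r" "1/2"] by auto
  from this[of M "Suc M"] sep[of "r M" "r (Suc M)"] r(1) show False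
    by (simp add: dist_norm strict_mono_Suc_iff)
qed

section \<open>Uniform lower bound for a collectively compact family\<close>

text \<open>Unit vectors that violate the bound ever more strongly are almost fixed by their
  operators. Their images share the compact set \<open>K\<close>, so a subsequence converges to a
  unit vector, which strong convergence makes a fixed point of \<open>A0\<close>.\<close>

lemma collectively_compact_bounded_below:
  fixes A :: "real \<Rightarrow> 'l \<Rightarrow> 'a::real_normed_vector \<Rightarrow> 'a"
  assumes lin: "\<And>\<epsilon> l. \<epsilon> > 0 \<Longrightarrow> l \<in> \<Lambda> \<Longrightarrow> bounded_linear (A \<epsilon> l)"
    and K: "compact K" "\<And>\<epsilon> l u. \<epsilon> > 0 \<Longrightarrow> l \<in> \<Lambda> \<Longrightarrow> norm u \<le> 1 \<Longrightarrow> A \<epsilon> l u \<in> K"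
    and lim: "\<And>u. uniform_limit \<Lambda> (\<lambda>\<epsilon> l. norm (A \<epsilon> l u - A0 u)) (\<lambda>l. 0) (at_right 0)"
    and ker: "\<And>u. A0 u = u \<Longrightarrow> u = 0"
  shows "\<exists>c>0. \<exists>e>0. \<forall>\<epsilon>\<in>{0<..e}. \<forall>l\<in>\<Lambda>. \<forall>u. c * norm u \<le> norm (u - A \<epsilon> l u)"
proof (rule ccontr)
  define \<tau> where "\<tau> n = inverse (real (Suc n))" for n
  have \<tau>: "\<tau> n > 0" for n by (simp add: \<tau>_def)
  have \<tau>0: "\<tau> \<longlonglongrightarrow> 0" unfolding \<tau>_def by (rule LIMSEQ_inverse_real_of_nat)
  assume "\<not> ?thesis"
  \<comment> \<open>\<open>\<tau> n\<close> serves both as the constant \<open>c\<close> and as the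
    threshold \<open>e\<close> of the negated claim.\<close>
  then have "\<forall>n. \<exists>\<epsilon>\<in>{0<..\<tau> n}. \<exists>l\<in>\<Lambda>. \<exists>u. norm (u - A \<epsilon> l u) < \<tau> n * norm u"
    using \<tau> by (meson not_le)
  then obtain \<epsilon> l w where *: "\<And>n. \<epsilon> n \<in> {0<..\<tau> n}" "\<And>n. l n \<in> \<Lambda>"
    "\<And>n. norm (w n - A (\<epsilon> n) (l n) (w n)) < \<tau> n * norm (w n)"
    by metis
  define B where "B n = A (\<epsilon> n) (l n)" for n
  have B: "bounded_linear (B n)" for n
    unfolding B_def using * by (intro lin) auto
  have BK: "B n u \<in> K" if "norm u \<le> 1" for n u
    unfolding B_def using * that by (intro K) auto
  obtain M where M: "\<And>u. u \<in> K \<Longrightarrow> norm u \<le> M"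
    using compact_imp_bounded[OF \<open>compact K\<close>] unfolding bounded_iff by blast
  \<comment> \<open>Boundedness of \<open>K\<close> yields an operator bound common to all
    \<open>B n\<close>.\<close>
  have BM: "norm (B n u) \<le> M * norm u" for n u
  proof -
    interpret bounded_linear "B n" by (rule B)
    show ?thesis
    proof (cases "u = 0")
      case False
      have "norm (B n ((1 / norm u) *\<^sub>R u)) \<le> M"
        by (intro M BK) simp
      then show ?thesis
        using False by (simp add: scale field_simps)
    qed (simp add: zero)
  qed
  define v where "v n = (1 / norm (w n)) *\<^sub>R w n" for n
  have w: "w n \<noteq> 0" for n
    using *(3)[of n] linear_0[OF bounded_linear.linear[OF B[of n]]] by (auto simp: B_def)
  have v: "norm (v n) = 1" for n
    using w by (simp add: v_def)
  have small: "norm (v n - B n (v n)) \<le> \<tau> n" for n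
  proof -
    interpret bounded_linear "B n" by (rule B)
    have "v n - B n (v n) = (1 / norm (w n)) *\<^sub>R (w n - B n (w n))"
      by (simp add: v_def scale scaleR_diff_right)
    then show ?thesis
      using *(3)[of n] w[of n] by (simp add: B_def pos_divide_le_eq)
  qed
  have "B n (v n) \<in> K" for n
    using v by (intro BK) simp
  with \<open>compact K\<close> obtain x r where r: "strict_mono r" "((\<lambda>n. B n (v n)) \<circ> r) \<longlonglongrightarrow> x"
    unfolding compact_def by meson
  have Bv: "(\<lambda>n. B (r n) (v (r n))) \<longlonglongrightarrow> x"
    using r(2) by (simp add: o_def)
  have "(\<lambda>n. v n - B n (v n)) \<longlonglongrightarrow> 0"
    by (rule Lim_null_comparison[OF _ \<tau>0]) (simp add: small)
  \<comment> \<open>Write \<open>v = (v - B v) + B v\<close>: the first term vanishes in the limit,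
    the second tends to \<open>x\<close>.\<close>
  from tendsto_add[OF LIMSEQ_subseq_LIMSEQ[OF this r(1)] r(2)]
  have vx: "(\<lambda>n. v (r n)) \<longlonglongrightarrow> x"
    by (simp add: o_def)
  have lim0: "(\<lambda>n. M * norm (v (r n) - x)) \<longlonglongrightarrow> 0"
    using tendsto_mult_right_zero[OF tendsto_norm_zero[OF LIM_zero[OF vx]]] .
  have B_diff: "norm (B n y - B n z) \<le> M * norm (y - z)" for n y z
    using BM[of n "y - z"] linear_diff[OF bounded_linear.linear[OF B[of n]], of y z] by simp
  \<comment> \<open>Strong convergence applies only to a fixed vector; the common bound
    \<open>M\<close> allows \<open>v (r n)\<close> to be replaced by \<open>x\<close>.\<close>
  have "(\<lambda>n. B (r n) (v (r n)) - B (r n) x) \<longlonglongrightarrow> 0"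
    by (rule Lim_null_comparison[OF always_eventually lim0]) (intro allI B_diff)
  from tendsto_diff[OF Bv this] have Bx: "(\<lambda>n. B (r n) x) \<longlonglongrightarrow> x"
    by simp
  have \<epsilon>: "filterlim \<epsilon> (at_right 0) sequentially"
  proof (rule tendsto_imp_filterlim_at_right)
    show "\<epsilon> \<longlonglongrightarrow> 0"
      using *(1) by (intro Lim_null_comparison[OF always_eventually \<tau>0]) (simp add: less_imp_le)
    show "\<forall>\<^sub>F n in sequentially. \<epsilon> n > 0"
      using *(1) by simp
  qed
  have "(\<lambda>n. B n x) \<longlonglongrightarrow> A0 x"
  proof (rule tendstoI)
    fix e :: real assume "e > 0"
    from uniform_limitD[OF lim[of x] this] \<epsilon>
    have "\<forall>\<^sub>F n in sequentially. \<forall>l\<in>\<Lambda>. dist (norm (A (\<epsilon> n) l x - A0 x)) 0 < e"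
      unfolding filterlim_iff by blast
    then show "\<forall>\<^sub>F n in sequentially. dist (B n x) (A0 x) < e"
      by eventually_elim (use *(2) in \<open>auto simp: B_def dist_norm\<close>)
  qed
  from LIMSEQ_unique[OF LIMSEQ_subseq_LIMSEQ[OF this r(1), unfolded o_def] Bx]
  have "x = 0" by (rule ker)
  moreover have "norm x = 1"
    using LIMSEQ_unique[OF tendsto_norm[OF vx]] v by simp
  ultimately show False by simp
qed

section \<open>Fixed points by a simplified Newton iteration\<close>

text \<open>Applying \<open>I - A\<close> to \<open>G x - G y\<close> leaves the increment of
  \<open>f - A\<close>, whose Lipschitz constant on the ball is \<open>c / 2\<close>; the lower
  bound \<open>c\<close> turns this into the contraction factor 1/2 for \<open>G\<close>.\<close>

lemma Newton_fixed_point: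
  fixes f :: "'a::banach \<Rightarrow> 'a"
  assumes A: "bounded_linear A" and surj: "surj (\<lambda>x. x - A x)"
    and c: "c > 0" and lower: "\<And>x. c * norm x \<le> norm (x - A x)"
    and der: "\<And>x. x \<in> cball a d \<Longrightarrow> (f has_derivative f' x) (at x)"
    and near: "\<And>x v. x \<in> cball a d \<Longrightarrow> norm (f' x v - A v) \<le> c / 2 * norm v"
    and d: "d > 0" and start: "norm (f a - a) \<le> c * d / 2"
  shows "\<exists>!u. u = f u \<and> norm (u - a) \<le> d"
    and "\<And>u. u = f u \<Longrightarrow> norm (u - a) \<le> d \<Longrightarrow> norm (u - a) \<le> 2 / c * norm (f a - a)"
proof -
  interpret A: bounded_linear A by (rule A)
  define J where "J = inv (\<lambda>x. x - A x)"
  have J: "J y - A (J y) = y" for y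
    unfolding J_def by (rule surj_f_inv_f[OF surj])
  define G where "G u = u + J (f u - u)" for u
  have G_eq: "(G x - G y) - A (G x - G y) = (f x - A x) - (f y - A y)" for x y
  proof -
    have "A (J z) = J z - z" for z
      using J[of z] by (simp add: algebra_simps)
    then show ?thesis
      by (simp add: G_def A.add A.diff)
  qed
  have G_lip: "norm (G x - G y) \<le> 1 / 2 * norm (x - y)"
    if "x \<in> cball a d" "y \<in> cball a d" for x y
  proof -
    have "norm ((f x - A x) - (f y - A y)) \<le> c / 2 * norm (x - y)"
    proof (rule differentiable_bound[OF convex_cball _ _ that])
      fix z assume z: "z \<in> cball a d"
      show "((\<lambda>x. f x - A x) has_derivative (\<lambda>v. f' z v - A v)) (at z within cball a d)"
        using has_derivative_at_withinI[OF der[OF z]] A.has_derivative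
        by (auto intro!: derivative_eq_intros bounded_linear_imp_has_derivative A)
      show "onorm (\<lambda>v. f' z v - A v) \<le> c / 2"
        using near[OF z] c by (intro onorm_bound) auto
    qed
    with lower[of "G x - G y"] have "c * norm (G x - G y) \<le> c * (1 / 2 * norm (x - y))"
      by (simp add: G_eq)
    with c show ?thesis by (simp only: mult_le_cancel_left_pos)
  qed
  have G_fix: "G u = u \<longleftrightarrow> u = f u" for u
  proof
    assume "G u = u"
    then have "J (f u - u) = 0" by (simp add: G_def)
    with J[of "f u - u"] show "u = f u" by (simp add: A.zero)
  next
    assume "u = f u"
    then have "J (f u - u) - A (J (f u - u)) = 0" using J[of "f u - u"] by simp
    with lower[of "J (f u - u)"] c have "J (f u - u) = 0"
      by (simp add: mult_le_0_iff)
    then show "G u = u" by (simp add: G_def)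
  qed
  have Ga: "norm (G a - a) \<le> norm (f a - a) / c"
    using lower[of "J (f a - a)"] c unfolding J by (simp add: G_def pos_le_divide_eq mult.commute)
  have Ga': "norm (G a - a) \<le> d / 2"
  proof -
    have "norm (f a - a) / c \<le> d / 2"
      using start c by (simp add: field_simps)
    with Ga show ?thesis by linarith
  qed
  \<comment> \<open>Used twice: with \<open>Ga'\<close> it gives the self-map property as d/2 + d/2;
    at a fixed point the term with 1/2 is absorbed on the left, which produces the factor
    \<open>2 / c\<close>.\<close>
  have dist_a: "norm (G u - a) \<le> 1 / 2 * norm (u - a) + norm (G a - a)" if "u \<in> cball a d" for u
    using G_lip[OF that, of a] d norm_triangle_ineq[of "G u - G a" "G a - a"] by simp
  have in_cball: "u \<in> cball a d \<longleftrightarrow> norm (u - a) \<le> d" for u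
    by (simp add: dist_norm norm_minus_commute)
  have "norm (G u - a) \<le> d" if "norm (u - a) \<le> d" for u
    using dist_a[unfolded in_cball, OF that] Ga' that by linarith
  then have "G ` cball a d \<subseteq> cball a d"
    unfolding image_subset_iff Ball_def in_cball by blast
  then have "\<exists>!u\<in>cball a d. G u = u"
    using d G_lip
    by (intro Banach_fix[where c = "1/2"]) (auto simp: complete_eq_closed dist_norm)
  then show "\<exists>!u. u = f u \<and> norm (u - a) \<le> d"
    unfolding in_cball G_fix by (metis (no_types, lifting))
  fix u assume "u = f u" "norm (u - a) \<le> d"
  then show "norm (u - a) \<le> 2 / c * norm (f a - a)"
    using dist_a[of u, unfolded in_cball] Ga G_fix[of u] by simp
qed

section \<open>Pointwise estimates from the joint limit and the supremum\<close>

lemma eventually_eps_norm_to_0: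
  "eventually P eps_norm_to_0 \<longleftrightarrow>
     (\<exists>d>0. \<forall>\<epsilon> u. \<epsilon> > 0 \<longrightarrow> \<epsilon> + norm u < d \<longrightarrow> P (\<epsilon>, u))" (is "?l \<longleftrightarrow> ?r")
proof
  assume ?l
  then obtain S where S: "open S" "0 \<in> S" "\<And>\<epsilon> u. \<epsilon> + norm u \<in> S \<Longrightarrow> \<epsilon> > 0 \<Longrightarrow> P (\<epsilon>, u)"
    by (auto simp: eps_norm_to_0_def eventually_inf_principal eventually_filtercomap_nhds)
  then obtain d where d: "d > 0" "ball 0 d \<subseteq> S"
    using open_contains_ball by blast
  have "P (\<epsilon>, u)" if "\<epsilon> > 0" "\<epsilon> + norm u < d" for \<epsilon> and u :: 'a
    using that d by (intro S) (auto intro!: subsetD[OF d(2)])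
  with d show ?r by blast
next
  assume ?r
  then obtain d where "d > 0" "\<And>\<epsilon> u. \<epsilon> > 0 \<Longrightarrow> \<epsilon> + norm u < d \<Longrightarrow> P (\<epsilon>, u)"
    by blast
  then show ?l
    unfolding eps_norm_to_0_def eventually_inf_principal eventually_filtercomap_nhds
    \<comment> \<open>A half-line suffices as neighbourhood of 0, since only the upper bound on
      \<open>\<epsilon> + norm u\<close> matters.\<close>
    by (intro exI[of _ "{..<d}"]) auto
qed

text \<open>A real \<open>SUP\<close> is an upper bound only over a set bounded above; boundedness
  of \<open>f\<close> supplies this, and homogeneity extends the bound beyond the unit ball.\<close>

lemma bounded_linear_norm_le_SUP_unit_ball:
  assumes "bounded_linear f"
  shows "norm (f v) \<le> (SUP v\<in>{v. norm v \<le> 1}. norm (f v)) * norm v"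
proof -
  interpret bounded_linear f by fact
  obtain K where K: "\<And>x. norm (f x) \<le> norm x * K" "K > 0"
    using pos_bounded by blast
  have "bdd_above ((\<lambda>v. norm (f v)) ` {v. norm v \<le> 1})"
  proof (rule bdd_aboveI2)
    fix x :: 'a assume "x \<in> {v. norm v \<le> 1}"
    then show "norm (f x) \<le> 1 * K"
      using K by (intro order_trans[OF K(1)] mult_right_mono) auto
  qed
  then have *: "norm (f x) \<le> (SUP v\<in>{v. norm v \<le> 1}. norm (f v))" if "norm x \<le> 1" for x
    using that by (intro cSUP_upper) auto
  show ?thesis
  proof (cases "v = 0")
    case False
    then show ?thesis
      using *[of "(1 / norm v) *\<^sub>R v"] by (simp add: scale field_simps)
  qed (simp add: zero)
qed

section \<open>Existence, uniqueness and error estimate\<close>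

theorem theorem2p1:
  fixes j :: "'v::banach \<Rightarrow> 'u::banach"
    and \<Lambda> :: "'l set"
    and F :: "real \<Rightarrow> 'l \<Rightarrow> 'u \<Rightarrow> 'v"
    and F0 :: "'u \<Rightarrow> 'v"
    and u0 :: 'u
  assumes diff_F: "\<And>\<epsilon> l u. \<epsilon> > 0 \<Longrightarrow> l \<in> \<Lambda> \<Longrightarrow> F \<epsilon> l differentiable (at u)"
    and diff_F0: "\<And>u. F0 differentiable (at u)"
    and embedding: "compact_embedding j"
    and fixed_point: "u0 = j (F0 u0)"
    and kernel: "{u. u - j (fderiv F0 u0 u) = 0} = {0}"
    and bound: "bdd_above {norm (fderiv (F \<epsilon> l) u0 u) | \<epsilon> l u. \<epsilon> > 0 \<and> l \<in> \<Lambda> \<and> norm u \<le> 1}"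
    and deriv_cont: "uniform_limit \<Lambda>
          (\<lambda>(\<epsilon>, u) l. SUP v\<in>{v. norm v \<le> 1}.
             norm (j (fderiv (F \<epsilon> l) (u0 + u) v) - j (fderiv (F \<epsilon> l) u0 v)))
          (\<lambda>l. 0) eps_norm_to_0"
    and value_lim: "uniform_limit \<Lambda>
          (\<lambda>\<epsilon> l. norm (j (F \<epsilon> l u0) - j (F0 u0))) (\<lambda>l. 0) (at_right 0)"
    and deriv_lim: "\<And>u. uniform_limit \<Lambda>
          (\<lambda>\<epsilon> l. norm (j (fderiv (F \<epsilon> l) u0 u) - j (fderiv F0 u0 u))) (\<lambda>l. 0) (at_right 0)"
  shows "\<exists>\<epsilon>0>0. \<exists>\<delta>>0.
      (\<forall>\<epsilon>\<in>{0<..\<epsilon>0}. \<forall>l\<in>\<Lambda>. \<exists>!u. u = j (F \<epsilon> l u) \<and> norm (u - u0) \<le> \<delta>) \<and>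
      (\<exists>\<rho>>0. \<forall>\<epsilon>\<in>{0<..\<epsilon>0}. \<forall>l\<in>\<Lambda>. \<forall>u.
         u = j (F \<epsilon> l u) \<and> norm (u - u0) \<le> \<delta> \<longrightarrow>
           norm (u - u0) \<le> \<rho> * norm (j (F \<epsilon> l u0) - j (F0 u0)))"
proof -
  have j: "bounded_linear j" and cpt: "\<And>B. bounded B \<Longrightarrow> compact (closure (j ` B))"
    using embedding by (auto simp: compact_embedding_def)
  define D where "D \<epsilon> l u v = j (fderiv (F \<epsilon> l) u v)" for \<epsilon> l u v
  have der: "((\<lambda>u. j (F \<epsilon> l u)) has_derivative D \<epsilon> l u) (at u)" if "\<epsilon> > 0" "l \<in> \<Lambda>" for \<epsilon> l u
    unfolding D_def using diff_F[OF that] frechet_derivative_works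
    by (blast intro: bounded_linear.has_derivative[OF j])
  have lin: "bounded_linear (D \<epsilon> l u)" if "\<epsilon> > 0" "l \<in> \<Lambda>" for \<epsilon> l u
    using der[OF that] by (rule has_derivative_bounded_linear)
  obtain M where M: "\<And>\<epsilon> l u. \<epsilon> > 0 \<Longrightarrow> l \<in> \<Lambda> \<Longrightarrow> norm u \<le> 1 \<Longrightarrow> norm (fderiv (F \<epsilon> l) u0 u) \<le> M"
    using bound unfolding bdd_above_def by blast
  \<comment> \<open>\<open>M\<close> bounds the derivatives at \<open>u0\<close> in the norm of V,
    so the compact embedding sends all images of the unit ball into this one compact set.\<close>
  define K where "K = closure (j ` cball 0 M)"
  have K: "compact K" unfolding K_def by (intro cpt) simp
  have DK: "D \<epsilon> l u0 u \<in> K" if "\<epsilon> > 0" "l \<in> \<Lambda>" "norm u \<le> 1" for \<epsilon> l u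
    unfolding K_def D_def using M[OF that] by (intro subsetD[OF closure_subset]) auto
  obtain c e1 where c: "c > 0" and e1: "e1 > 0"
    and lower: "\<And>\<epsilon> l u. \<epsilon> \<in> {0<..e1} \<Longrightarrow> l \<in> \<Lambda> \<Longrightarrow> c * norm u \<le> norm (u - D \<epsilon> l u0 u)"
    using collectively_compact_bounded_below[where A = "\<lambda>\<epsilon> l. D \<epsilon> l u0",
        OF lin K DK deriv_lim[folded D_def]] kernel by force
  have surj: "surj (\<lambda>u. u - D \<epsilon> l u0 u)" if "\<epsilon> \<in> {0<..e1}" "l \<in> \<Lambda>" for \<epsilon> l
  proof (rule Fredholm_surj[OF _ _ c lower[OF that]])
    show "bounded_linear (D \<epsilon> l u0)" using that by (intro lin) auto
    have "D \<epsilon> l u0 ` cball 0 1 \<subseteq> K" using that by (auto intro!: DK)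
    then have "closure (D \<epsilon> l u0 ` cball 0 1) \<subseteq> K"
      by (simp add: closure_minimal K_def)
    then show "compact (closure (D \<epsilon> l u0 ` cball 0 1))"
      using K by (metis closed_closure compact_Int_closed inf.absorb_iff2)
  qed
  have "\<forall>\<^sub>F (\<epsilon>, u) in eps_norm_to_0. \<forall>l\<in>\<Lambda>.
      (SUP v\<in>{v. norm v \<le> 1}. norm (D \<epsilon> l (u0 + u) v - D \<epsilon> l u0 v)) < c / 2"
    using uniform_limitD[OF deriv_cont, of "c / 2"] c
    by (auto simp: D_def case_prod_unfold elim!: eventually_mono)
  then obtain d where d: "d > 0" and SUP_less:
    "\<And>\<epsilon> u l. \<epsilon> > 0 \<Longrightarrow> \<epsilon> + norm u < d \<Longrightarrow> l \<in> \<Lambda> \<Longrightarrow>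
       (SUP v\<in>{v. norm v \<le> 1}. norm (D \<epsilon> l (u0 + u) v - D \<epsilon> l u0 v)) < c / 2"
    unfolding eventually_eps_norm_to_0 by auto
  \<comment> \<open>With \<open>\<epsilon>\<close> and \<open>norm (x - u0)\<close> both at most
    \<open>d/3\<close>, their sum stays strictly below \<open>d\<close>.\<close>
  have near: "norm (D \<epsilon> l x v - D \<epsilon> l u0 v) \<le> c / 2 * norm v"
    if "\<epsilon> \<in> {0<..d/3}" "l \<in> \<Lambda>" "x \<in> cball u0 (d/3)" for \<epsilon> l x v
  proof -
    have "bounded_linear (\<lambda>v. D \<epsilon> l x v - D \<epsilon> l u0 v)"
      using that by (intro bounded_linear_sub lin) auto
    then have "norm (D \<epsilon> l x v - D \<epsilon> l u0 v)
        \<le> (SUP v\<in>{v. norm v \<le> 1}. norm (D \<epsilon> l x v - D \<epsilon> l u0 v)) * norm v"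
      by (rule bounded_linear_norm_le_SUP_unit_ball)
    also have "\<dots> \<le> c / 2 * norm v"
      using SUP_less[of \<epsilon> "x - u0" l] that d
      by (intro mult_right_mono) (auto simp: dist_norm norm_minus_commute)
    finally show ?thesis .
  qed
  \<comment> \<open>This threshold is the starting condition of the Newton lemma for the radius
    \<open>d/3\<close>.\<close>
  have "\<forall>\<^sub>F \<epsilon> in at_right 0. \<forall>l\<in>\<Lambda>. norm (j (F \<epsilon> l u0) - u0) < c * (d/3) / 2"
    using uniform_limitD[OF value_lim, of "c * (d/3) / 2"] c d
    by (simp flip: fixed_point)
  then obtain e2 where e2: "e2 > 0"
    "\<And>\<epsilon> l. \<epsilon> > 0 \<Longrightarrow> \<epsilon> < e2 \<Longrightarrow> l \<in> \<Lambda> \<Longrightarrow> norm (j (F \<epsilon> l u0) - u0) < c * (d/3) / 2"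
    unfolding eventually_at_right_field by auto
  \<comment> \<open>Halving \<open>e2\<close> accounts for the closed end of \<open>{0<..e}\<close>,
    as the estimate behind \<open>e2\<close> requires \<open>\<epsilon> < e2\<close>.\<close>
  define e where "e = min e1 (min (d/3) (e2/2))"
  have e: "e > 0" using e1 d e2 by (simp add: e_def)
  have d3: "d / 3 > 0" using d by simp
  have *: "\<exists>!u. u = j (F \<epsilon> l u) \<and> norm (u - u0) \<le> d/3"
    "\<And>u. u = j (F \<epsilon> l u) \<Longrightarrow> norm (u - u0) \<le> d/3 \<Longrightarrow>
       norm (u - u0) \<le> 2 / c * norm (j (F \<epsilon> l u0) - j (F0 u0))"
    if "\<epsilon> \<in> {0<..e}" "l \<in> \<Lambda>" for \<epsilon> l
  proof -
    have \<epsilon>: "\<epsilon> > 0" "\<epsilon> \<in> {0<..e1}" "\<epsilon> \<in> {0<..d/3}" "\<epsilon> < e2"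
      using that e2 by (auto simp: e_def)
    have start: "norm (j (F \<epsilon> l u0) - u0) \<le> c * (d/3) / 2"
      using e2 \<epsilon> that by (intro less_imp_le) auto
    note Newton = Newton_fixed_point[where f = "\<lambda>u. j (F \<epsilon> l u)", OF lin[OF \<epsilon>(1) that(2)]
        surj[OF \<epsilon>(2) that(2)] c lower[OF \<epsilon>(2) that(2)] der[OF \<epsilon>(1) that(2)]
        near[OF \<epsilon>(3) that(2)] d3 start]
    show "\<exists>!u. u = j (F \<epsilon> l u) \<and> norm (u - u0) \<le> d/3"
      by (rule Newton(1))
    show "norm (u - u0) \<le> 2 / c * norm (j (F \<epsilon> l u0) - j (F0 u0))"
      if "u = j (F \<epsilon> l u)" "norm (u - u0) \<le> d/3" for u
      unfolding fixed_point[symmetric] by (rule Newton(2)[OF _ that])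
  qed
  have "2 / c > 0" using c by simp
  with * have estimate: "\<exists>\<rho>>0. \<forall>\<epsilon>\<in>{0<..e}. \<forall>l\<in>\<Lambda>. \<forall>u. u = j (F \<epsilon> l u) \<and> norm (u - u0) \<le> d/3 \<longrightarrow>
      norm (u - u0) \<le> \<rho> * norm (j (F \<epsilon> l u0) - j (F0 u0))"
    by (intro exI[of _ "2 / c"]) simp
  have unique: "\<forall>\<epsilon>\<in>{0<..e}. \<forall>l\<in>\<Lambda>. \<exists>!u. u = j (F \<epsilon> l u) \<and> norm (u - u0) \<le> d/3"
    by (intro ballI *(1))
  show ?thesis
    by (rule exI[of _ e], rule conjI[OF e], rule exI[of _ "d/3"])
      (rule conjI[OF d3 conjI[OF unique estimate]])
qed

end
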